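(* Let $f:\mathbb{N}\to\mathbb{Z}$ satisfy $0\le f(n)\le n$ for all $n$, and suppose \[ \lim_{n\to\infty}\frac{f(n)\log\log n}{n}=\infty. \] Then there exists a function $\Psi:\mathbb{N}\to\mathbb{R}_{\geq0}$ such that $\sum_{n=1}^\infty f(n)\Psi(n)$ diverges, yet $\lambda(W(\Psi))=0$.
   Context: $[n]=\{1,\dots,n\}$. For $\Psi:\mathbb{N}\to\mathbb{R}_{\ge0}$, $W(\Psi)$ is the set of $x\in[0,1]$ such that $|x-a/n|<\Psi(n)$ for infinitely many pairs $(n,a)$ with $n\in\mathbb{N}$, $a\in[n]$. $\lambda$ is Lebesgue measure. *)

theory Defs
  imports "HOL-Analysis.Analysis"
begin

text \<open>The natural numbers start at \<open>1\<close>: index \<open>0\<close> of a function on \<^typ>\<open>nat\<close> plays no role.\<close>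

definition W :: "(nat \<Rightarrow> real) \<Rightarrow> real set" where
  "W \<Psi> = {x \<in> {0..1}.
     infinite {(n, a). n \<ge> 1 \<and> a \<in> {1..n} \<and> \<bar>x - real a / real n\<bar> < \<Psi> n}}"

end

theory Submission
  imports Defs
begin

text \<open>
  For \<open>N = y!\<close>, every fraction whose denominator divides \<open>N\<close> is a multiple of \<open>1/N\<close>, so giving
  all divisors \<open>n = N/d\<close> with \<open>d \<le> y\<close> the same radius \<open>\<epsilon>/N\<close> covers only measure \<open>2\<epsilon>\<close>. On the
  other hand \<open>\<Sum>n/N = \<Sum>1/d \<ge> log y \<ge> (log log N)/2\<close> over these divisors, so if \<open>f n \<ge> C n / log log n\<close>
  on them, they contribute at least \<open>C\<epsilon>/2\<close> to the series. Taking \<open>\<epsilon> = 2\<^sup>-\<^sup>k\<close> and \<open>C = 2\<^sup>k\<close> for a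
  rapidly growing sequence of values \<open>y\<^sub>k\<close>, the series diverges, while the exceptional set is null
  by Borel--Cantelli.
\<close>

text \<open>Since \<open>d \<le> y\<close>, the cofactor is at least \<open>(y - 1)!\<close>. The
  bound pushes a whole block of denominators past any prescribed threshold.\<close>

lemma pred_le_fact_div:
  fixes y d :: nat
  assumes "d \<in> {1..y}"
  shows "y - 1 \<le> fact y div d"
proof -
  have y: "fact y = y * fact (y - 1)"
    using assms fact_reduce[of y, where ?'a = nat] by simp
  have "d * fact (y - 1) \<le> (fact y :: nat)"
    using assms y by simp
  then have "fact (y - 1) \<le> (fact y div d :: nat)"
    using assms by (simp add: less_eq_div_iff_mult_less_eq mult.commute)
  then show "y - 1 \<le> fact y div d"
    using fact_ge_self[of "y - 1"] by linarith
qed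

text \<open>From \<open>y! \<le> y ^ y\<close> and \<open>ln y \<le> y\<close> one gets
  \<open>ln (y!) \<le> y * y\<close>.\<close>

lemma ln_ln_fact_le:
  assumes "y \<ge> 2"
  shows "ln (ln (fact y :: real)) \<le> 2 * ln (real y)"
proof -
  have f1: "(fact y :: real) > 1"
    using assms fact_ge_self[of y] by (metis fact_2 fact_mono less_le_trans numeral_One numeral_less_iff semiring_norm(76))
  have "(fact y :: real) \<le> real y ^ y"
    by (metis fact_le_power le_refl of_nat_fact of_nat_power)
  then have "ln (fact y :: real) \<le> ln (real y ^ y)"
    using f1 assms by (subst ln_le_cancel_iff) auto
  also have "\<dots> = real y * ln (real y)"
    using assms by (simp add: ln_realpow)
  also have "\<dots> \<le> real y * real y"
    using assms by (intro mult_left_mono) (auto intro: less_imp_le ln_less_self)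
  finally have "ln (ln (fact y :: real)) \<le> ln (real y * real y)"
    using f1 assms by (subst ln_le_cancel_iff) auto
  also have "\<dots> = 2 * ln (real y)"
    using assms by (simp add: ln_mult)
  finally show ?thesis .
qed

text \<open>For \<open>n = y!/d\<close> the hypothesis and \<open>ln (ln n) \<le> 2 * ln y\<close>
  give \<open>g n \<ge> C * n / (2 * ln y)\<close>. As \<open>n / y! = 1/d\<close>, summing over
  \<open>d\<close> produces a harmonic sum, whose lower bound \<open>ln y\<close> cancels the
  denominator.\<close>

lemma sum_over_cofactors_of_fact_ge:
  fixes g :: "nat \<Rightarrow> real" and C :: real and y :: nat
  assumes y: "y \<ge> 4" and C: "C \<ge> 0"
    and g: "\<And>d. d \<in> {1..y} \<Longrightarrow>
      C \<le> g (fact y div d) * ln (ln (real (fact y div d))) / real (fact y div d)"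
  shows "C / 2 \<le> (\<Sum>d=1..y. g (fact y div d) / fact y)"
proof -
  have lny: "ln (real y) > 0"
    using y by simp
  have *: "C / (2 * ln (real y)) * inverse (real d) \<le> g (fact y div d) / fact y"
    if d: "d \<in> {1..y}" for d
  proof -
    define n :: nat where "n = fact y div d"
    have dn: "d * n = fact y"
      using d by (auto simp: n_def intro!: dvd_mult_div_cancel dvd_fact)
    \<comment> \<open>This is where \<open>y \<ge> 4\<close> enters: beyond e the iterated logarithm
      is positive.\<close>
    have n3: "n \<ge> 3"
      using pred_le_fact_div[OF d] y by (simp add: n_def)
    then have "ln 3 \<le> ln (real n)"
      by (subst ln_le_cancel_iff) auto
    then have ln1: "ln (real n) > 1"
      using ln3_gt_1 by linarith
    have "real n \<le> fact y"
      by (metis div_le_dividend n_def of_nat_fact of_nat_le_iff)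
    then have "ln (ln (real n)) \<le> ln (ln (fact y))"
      using n3 ln1 by (intro ln_mono) auto
    with ln_ln_fact_le[of y] y have ll: "ln (ln (real n)) \<le> 2 * ln (real y)"
      by simp
    have ll0: "ln (ln (real n)) > 0"
      using ln1 by simp
    have Cn: "C * real n \<le> g n * ln (ln (real n))"
      using g[OF d] n3 by (simp add: n_def[symmetric] field_simps)
    \<comment> \<open>The sign of \<open>g n\<close> is needed to replace \<open>ln (ln n)\<close>
      by the larger \<open>2 * ln y\<close>.\<close>
    then have "0 \<le> g n"
      using C n3 ll0 by (smt (verit) mult_neg_pos mult_nonneg_nonneg of_nat_0_le_iff)
    then have "C * real n \<le> g n * (2 * ln (real y))"
      using Cn ll by (smt (verit) mult_left_mono)
    then have "C / (2 * ln (real y)) * real n \<le> g n"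
      using lny by (simp add: field_simps)
    then have "C / (2 * ln (real y)) * (real n / fact y) \<le> g n / fact y"
      by (simp add: field_simps)
    moreover have "real n / fact y = inverse (real d)"
    proof -
      have "fact y = real d * real n"
        by (metis dn of_nat_fact of_nat_mult)
      then show ?thesis
        using n3 by (simp add: field_simps)
    qed
    ultimately show ?thesis
      by (simp only: n_def)
  qed
  have "ln (real y) \<le> ln (real y + 1)"
    using y by (subst ln_le_cancel_iff) auto
  then have harm: "ln (real y) \<le> harm y"
    using ln_le_harm[of y] by linarith
  have "C / 2 = C / (2 * ln (real y)) * ln (real y)"
    using lny by simp
  also have "\<dots> \<le> C / (2 * ln (real y)) * harm y"
    using harm lny C by (intro mult_left_mono) auto
  also have "\<dots> = (\<Sum>d=1..y. C / (2 * ln (real y)) * inverse (real d))"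
    by (simp add: harm_def sum_distrib_left)
  also have "\<dots> \<le> (\<Sum>d=1..y. g (fact y div d) / fact y)"
    using * by (intro sum_mono) auto
  finally show ?thesis .
qed

lemma inj_on_fact_div: "inj_on (\<lambda>d. fact y div d :: nat) {1..y}"
proof (rule inj_onI)
  fix d e assume de: "d \<in> {1..y}" "e \<in> {1..y}" and eq: "fact y div d = (fact y div e :: nat)"
  have "d * (fact y div d) = (fact y :: nat)" "e * (fact y div e) = (fact y :: nat)"
    using de by (auto intro!: dvd_mult_div_cancel dvd_fact)
  with eq show "d = e"
    by (metis fact_nonzero mult_cancel2 mult_is_0)
qed

text \<open>The radius is scaled by \<open>1/N\<close> so that the total length of the
  \<open>N\<close> intervals is \<open>2 * e\<close>, independent of \<open>N\<close>.\<close>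

definition frac_nbhd :: "nat \<Rightarrow> real \<Rightarrow> real set" where
  "frac_nbhd N e = (\<Union>b\<in>{1..N}. {real b / real N - e / real N .. real b / real N + e / real N})"

lemma frac_nbhd_lmeasurable: "frac_nbhd N e \<in> lmeasurable"
  unfolding frac_nbhd_def by (intro fmeasurable.finite_UN) auto

lemma measure_frac_nbhd_le:
  assumes "e \<ge> 0"
  shows "measure lebesgue (frac_nbhd N e) \<le> 2 * e"
proof (cases "N = 0")
  case True
  then show ?thesis using assms by (simp add: frac_nbhd_def)
next
  case False
  have "measure lebesgue (frac_nbhd N e) \<le> (\<Sum>b\<in>{1..N}.
      measure lebesgue {real b / real N - e / real N .. real b / real N + e / real N})"
    unfolding frac_nbhd_def by (intro measure_UNION_le) auto
  also have "\<dots> = (\<Sum>b\<in>{1..N}. 2 * e / real N)"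
    using assms by (intro sum.cong) auto
  also have "\<dots> = 2 * e"
    using False by simp
  finally show ?thesis .
qed

text \<open>If \<open>n\<close> divides \<open>N\<close>, then \<open>a/n = (d * a)/N\<close> is one
  of the centres.\<close>

lemma in_frac_nbhd:
  assumes "d * n = N" "N > 0" "a \<in> {1..n}" "\<bar>x - real a / real n\<bar> < e / real N"
  shows "x \<in> frac_nbhd N e"
proof -
  have "real (d * a) / real N = real a / real n"
    using assms by (auto simp: field_simps)
  then have "x \<in> {real (d * a) / real N - e / real N .. real (d * a) / real N + e / real N}"
    using assms(4) unfolding atLeastAtMost_iff abs_less_iff by linarith
  moreover have "d * a \<in> {1..N}"
    using assms by auto
  ultimately show ?thesis
    unfolding frac_nbhd_def by blast
qed

theorem theorem1p8:
  fixes f :: "nat \<Rightarrow> int"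
  assumes "\<And>n. n \<ge> 1 \<Longrightarrow> 0 \<le> f n \<and> f n \<le> int n"
    and "filterlim (\<lambda>n. real_of_int (f n) * ln (ln (real n)) / real n) at_top sequentially"
  shows "\<exists>\<Psi> :: nat \<Rightarrow> real.
           (\<forall>n\<ge>1. 0 \<le> \<Psi> n) \<and>
           \<not> summable (\<lambda>n. real_of_int (f (Suc n)) * \<Psi> (Suc n)) \<and>
           W \<Psi> \<in> null_sets lebesgue"
proof -
  have "\<forall>k. \<exists>M. \<forall>n\<ge>M. 2 ^ k \<le> real_of_int (f n) * ln (ln (real n)) / real n"
    using assms(2) unfolding filterlim_at_top eventually_sequentially by blast
  then obtain M :: "nat \<Rightarrow> nat" where
    M: "\<And>k n. n \<ge> M k \<Longrightarrow> 2 ^ k \<le> real_of_int (f n) * ln (ln (real n)) / real n"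
    by metis
  \<comment> \<open>The sum, rather than \<open>M k\<close> alone, makes \<open>y\<close> monotone;
    the summand \<open>k + 4\<close> yields both \<open>y k \<ge> 4\<close> and
    \<open>y k > k\<close>, and leaves room for \<open>y k - 1 \<ge> M k\<close>.\<close>
  define y where "y k = k + 4 + (\<Sum>i\<le>k. M i)" for k
  have y4: "y k \<ge> 4" and yk: "y k > k" for k
    by (auto simp: y_def)
  have yM: "y k - 1 \<ge> M k" for k
  proof -
    have "M k \<le> (\<Sum>i\<le>k. M i)"
      by (intro member_le_sum) auto
    then show ?thesis by (simp add: y_def)
  qed
  have "mono y"
    unfolding y_def by (intro monoI add_mono sum_mono2) auto
  define c :: "nat \<Rightarrow> real" where "c k = (1/2) ^ k / real (fact (y k))" for k
  have c0: "c k > 0" for k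
    by (simp add: c_def)
  have c_anti: "c j \<le> c i" if "i \<le> j" for i j
    unfolding c_def using that \<open>mono y\<close>
    by (intro frac_le power_decreasing) (auto simp: monoD fact_mono simp del: of_nat_fact)
  define S where "S k = (\<lambda>d. fact (y k) div d :: nat) ` {1..y k}" for k
  have S_ge: "n \<ge> y k - 1" if "n \<in> S k" for n k
    using that pred_le_fact_div by (auto simp: S_def)
  have S_le: "n \<le> fact (y k)" if "n \<in> S k" for n k
    using that by (auto simp: S_def)
  have S_dvd: "\<exists>d. d * n = fact (y k)" if "n \<in> S k" for n k
  proof -
    from that obtain d where d: "d \<in> {1..y k}" "n = fact (y k) div d"
      by (auto simp: S_def)
    then have "d * n = fact (y k)"
      by (auto intro!: dvd_mult_div_cancel dvd_fact)
    then show ?thesis ..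
  qed
  \<comment> \<open>The blocks \<open>S k\<close> may overlap; as \<open>c\<close> decreases, the least index gives the largest radius.\<close>
  define \<Psi> :: "nat \<Rightarrow> real" where
    "\<Psi> n = (if \<exists>k. n \<in> S k then c (LEAST k. n \<in> S k) else 0)" for n
  have \<Psi>0: "\<Psi> n \<ge> 0" for n
    using c0 by (auto simp: \<Psi>_def intro: less_imp_le)
  have \<Psi>_ge: "c k \<le> \<Psi> n" if "n \<in> S k" for n k
    using that c_anti[OF Least_le[of "\<lambda>k. n \<in> S k" k]] by (auto simp: \<Psi>_def)
  have \<Psi>_eq: "\<exists>k. n \<in> S k \<and> \<Psi> n = c k" if "\<Psi> n > 0" for n
    using that by (auto simp: \<Psi>_def split: if_splits intro: LeastI)

  let ?h = "\<lambda>n. real_of_int (f n) * \<Psi> n"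
  have h0: "?h n \<ge> 0" if "n \<ge> 1" for n
    using assms(1)[OF that] \<Psi>0 by simp
  \<comment> \<open>The growth factor \<open>2 ^ k\<close> cancels the \<open>(1/2) ^ k\<close> in
    \<open>c k\<close>, so every block contributes at least a fixed amount.\<close>
  have block: "1 / 2 \<le> sum ?h (S k)" for k
  proof -
    have "(2 ^ k) / 2 \<le> (\<Sum>d=1..y k. real_of_int (f (fact (y k) div d)) / fact (y k))"
    proof (rule sum_over_cofactors_of_fact_ge)
      fix d assume "d \<in> {1..y k}"
      then have "M k \<le> fact (y k) div d"
        using pred_le_fact_div[of d "y k"] yM[of k] by linarith
      then show "2 ^ k \<le> real_of_int (f (fact (y k) div d)) * ln (ln (real (fact (y k) div d)))
          / real (fact (y k) div d)"
        by (rule M)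
    qed (use y4 in auto)
    then have "(1/2) ^ k * (2 ^ k / 2)
        \<le> (1/2) ^ k * (\<Sum>d=1..y k. real_of_int (f (fact (y k) div d)) / fact (y k))"
      by (intro mult_left_mono) auto
    moreover have "(1/2) ^ k * (2 ^ k / 2) = (1/2 :: real)"
      by (simp add: power_divide)
    ultimately have "1 / 2 \<le> (1/2) ^ k *
        (\<Sum>d=1..y k. real_of_int (f (fact (y k) div d)) / fact (y k))"
      by (simp only:)
    also have "\<dots> = (\<Sum>d=1..y k. real_of_int (f (fact (y k) div d)) * c k)"
      by (simp add: sum_distrib_left c_def mult_ac)
    also have "\<dots> = (\<Sum>n\<in>S k. real_of_int (f n) * c k)"
      unfolding S_def by (subst sum.reindex[OF inj_on_fact_div]) (simp add: o_def)
    also have "\<dots> \<le> sum ?h (S k)"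
    proof (intro sum_mono mult_left_mono)
      fix n assume n: "n \<in> S k"
      show "c k \<le> \<Psi> n" by (rule \<Psi>_ge[OF n])
      have "n \<ge> 1" using S_ge[OF n] y4[of k] by linarith
      then show "0 \<le> real_of_int (f n)" using assms(1) by simp
    qed
    finally show ?thesis .
  qed
  have div: "\<not> summable ?h"
  proof
    assume "summable ?h"
    then obtain N where N: "\<And>m n. m \<ge> N \<Longrightarrow> norm (sum ?h {m..<n}) < 1 / 2"
      unfolding summable_Cauchy by (meson half_gt_zero zero_less_one)
    \<comment> \<open>All of \<open>S k\<close> lies at or above \<open>k\<close>, so a single late
      block violates the Cauchy criterion and overlaps between blocks are harmless. Taking
      \<open>N + 1\<close> keeps out index 0, where the sign of \<open>f\<close> is unknown.\<close>
    define k where "k = N + 1"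
    have "sum ?h (S k) \<le> sum ?h {k..<Suc (fact (y k))}"
    proof (rule sum_mono2)
      show "S k \<subseteq> {k..<Suc (fact (y k))}"
        using S_ge S_le yk[of k] by fastforce
    qed (use h0 in \<open>auto simp: k_def\<close>)
    with block[of k] N[of k "Suc (fact (y k))"] show False
      by (simp add: k_def)
  qed

  let ?E = "\<lambda>k. frac_nbhd (fact (y k)) ((1/2) ^ k)"
  have AE: "AE x in lebesgue. eventually (\<lambda>k. x \<in> space lebesgue - ?E k) sequentially"
  proof (rule borel_cantelli_AE1)
    show "summable (\<lambda>k. measure lebesgue (?E k))"
    proof (rule summable_comparison_test'[where N = 0])
      show "summable (\<lambda>k. 2 * (1/2 :: real) ^ k)"
        by (intro summable_mult summable_geometric) auto
      show "norm (measure lebesgue (?E k)) \<le> 2 * (1/2) ^ k" for k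
        unfolding real_norm_def abs_of_nonneg[OF measure_nonneg]
        by (rule measure_frac_nbhd_le) simp
    qed
    show "?E k \<in> sets lebesgue" for k
      by (rule fmeasurableD[OF frac_nbhd_lmeasurable])
    show "emeasure lebesgue (?E k) < \<infinity>" for k
      using fmeasurableD2[OF frac_nbhd_lmeasurable, of "fact (y k)" "(1/2) ^ k"]
      by (simp only: less_top infinity_ennreal_def)
  qed
  have not_W: "x \<notin> W \<Psi>" if ev: "eventually (\<lambda>k. x \<in> space lebesgue - ?E k) sequentially" for x
  proof -
    from ev obtain K where K: "\<And>k. k \<ge> K \<Longrightarrow> x \<notin> ?E k"
      by (auto simp: eventually_sequentially)
    let ?P = "{(n, a). n \<ge> 1 \<and> a \<in> {1..n} \<and> \<bar>x - real a / real n\<bar> < \<Psi> n}"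
    \<comment> \<open>A pair with \<open>n\<close> in \<open>S k\<close> and
      \<open>\<Psi> n = c k\<close> puts \<open>x\<close> into \<open>?E k\<close>, hence
      \<open>k < K\<close>. Only finitely many denominators remain, each with finitely many
      numerators.\<close>
    have "?P \<subseteq> Sigma (\<Union>k<K. S k) (\<lambda>n. {1..n})"
    proof clarsimp
      fix n a :: nat
      assume a: "Suc 0 \<le> a" "a \<le> n" and lt: "\<bar>x - real a / real n\<bar> < \<Psi> n"
      then have "\<Psi> n > 0" by linarith
      then obtain k where k: "n \<in> S k" "\<Psi> n = c k" using \<Psi>_eq by blast
      obtain d where "d * n = fact (y k)" using S_dvd[OF k(1)] by blast
      then have "x \<in> ?E k"
        using a lt k(2) by (intro in_frac_nbhd) (auto simp: c_def)
      with K have "k < K" by (meson not_le)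
      with k(1) show "\<exists>k\<in>{..<K}. n \<in> S k" by blast
    qed
    moreover have "finite (Sigma (\<Union>k<K. S k) (\<lambda>n. {1..n}))"
      by (auto simp: S_def)
    ultimately have "finite ?P" by (rule finite_subset)
    then show ?thesis by (simp add: W_def)
  qed
  from AE obtain Z where Z: "Z \<in> null_sets lebesgue"
    "\<And>x. x \<in> space lebesgue - Z \<Longrightarrow> eventually (\<lambda>k. x \<in> space lebesgue - ?E k) sequentially"
    by (rule AE_E3) blast
  have "W \<Psi> \<subseteq> Z"
  proof
    fix x assume "x \<in> W \<Psi>"
    then show "x \<in> Z" using Z(2)[of x] not_W[of x] by auto
  qed
  \<comment> \<open>Completeness of Lebesgue measure gives measurability of \<open>W \<Psi>\<close>
    along with nullity.\<close>
  then have "W \<Psi> \<in> null_sets lebesgue"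
    using Z(1) by (rule null_sets_completion_subset)
  moreover have "\<not> summable (\<lambda>n. ?h (Suc n))"
    using div by (subst summable_Suc_iff)
  ultimately show ?thesis
    using \<Psi>0 by blast
qed

end
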